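(* For any congruence $I$ of a $\mathbb{B}$-algebra $A$ we have $$\mathrm{Rad}(I)=\{\alpha\in A\times A \mid GP(\alpha)\cap I\neq\emptyset\}.$$ In particular, the intersection of all prime congruences of $A$ is precisely the set of nilpotent pairs.
   Context: A semiring is a commutative semiring with additive identity $0$ and multiplicative identity $1$, with $1\neq 0$ and $a\cdot 0=0$ for all $a$. A $\mathbb{B}$-algebra is a semiring with idempotent addition ($a+a=a$ for all $a$). A congruence of $A$ is an equivalence relation $I\subseteq A\times A$ compatible with addition and multiplication; it is proper if $I\neq A\times A$. $\Delta$ denotes the trivial congruence (the diagonal of $A\times A$). Elements of $A\times A$ are called pairs; they are added coordinatewise, and their product (and powers) is always the twisted product $(\alpha_1,\alpha_2)(\beta_1,\beta_2)=(\alpha_1\beta_1+\alpha_2\beta_2,\ \alpha_1\beta_2+\alpha_2\beta_1)$, with $\alpha^0=(1,0)$. A congruence $P$ is prime if it is proper and for all pairs $\alpha,\beta$ with $\alpha\beta\in P$ we have $\alpha\in P$ or $\beta\in P$. $\mathrm{Rad}(I)$ is the intersection of all prime congruences containing $I$ (an empty intersection being $A\times A$). For a pair $\alpha=(\alpha_1,\alpha_2)$ put $\alpha^*=(\alpha_1+\alpha_2,0)$. The generalized powers of $\alpha$ are the pairs $\big((\alpha^* )^k+(c,0)\big)\alpha^l$ with $k,l$ non-negative integers and $c\in A$ arbitrary; the set of these is $GP(\alpha)$. A pair $\alpha$ is nilpotent if $GP(\alpha)\cap\Delta\neq\emptyset$. *)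

theory Defs
  imports Main "HOL-Library.Product_Plus"
begin

(* Class comm_semiring_1 already contains 0 \<noteq> 1 and a * 0 = 0.
   The algebra A is the whole type, so A \<times> A is UNIV. *)
class b_algebra = comm_semiring_1 +
  assumes add_idem: "a + a = a"

definition semiring_congruence :: "('a::comm_semiring_1 \<times> 'a) set \<Rightarrow> bool" where
  "semiring_congruence I \<longleftrightarrow>
     equiv UNIV I \<and>
     (\<forall>a b c d. (a, b) \<in> I \<longrightarrow> (c, d) \<in> I \<longrightarrow>
        (a + c, b + d) \<in> I \<and> (a * c, b * d) \<in> I)"

definition twist_mult ::
    "'a::comm_semiring_1 \<times> 'a \<Rightarrow> 'a \<times> 'a \<Rightarrow> 'a \<times> 'a"  (infixl "*\<^sub>t" 70) where
  "\<alpha> *\<^sub>t \<beta> =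
     (fst \<alpha> * fst \<beta> + snd \<alpha> * snd \<beta>, fst \<alpha> * snd \<beta> + snd \<alpha> * fst \<beta>)"

primrec twist_pow :: "'a::comm_semiring_1 \<times> 'a \<Rightarrow> nat \<Rightarrow> 'a \<times> 'a"  (infixr "^\<^sub>t" 80) where
  "\<alpha> ^\<^sub>t 0 = (1, 0)"
| "\<alpha> ^\<^sub>t (Suc n) = \<alpha> *\<^sub>t (\<alpha> ^\<^sub>t n)"

definition prime_congruence :: "('a::comm_semiring_1 \<times> 'a) set \<Rightarrow> bool" where
  "prime_congruence P \<longleftrightarrow>
     semiring_congruence P \<and> P \<noteq> UNIV \<and>
     (\<forall>\<alpha> \<beta>. \<alpha> *\<^sub>t \<beta> \<in> P \<longrightarrow> \<alpha> \<in> P \<or> \<beta> \<in> P)"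

(* If no prime congruence contains I, this is \<Inter>{} = UNIV, i.e. A \<times> A. *)
definition Rad :: "('a::comm_semiring_1 \<times> 'a) set \<Rightarrow> ('a \<times> 'a) set" where
  "Rad I = \<Inter>{P. prime_congruence P \<and> I \<subseteq> P}"

definition pair_star :: "'a::comm_semiring_1 \<times> 'a \<Rightarrow> 'a \<times> 'a" where
  "pair_star \<alpha> = (fst \<alpha> + snd \<alpha>, 0)"

definition GP :: "'a::comm_semiring_1 \<times> 'a \<Rightarrow> ('a \<times> 'a) set" where
  "GP \<alpha> = {(pair_star \<alpha> ^\<^sub>t k + (c, 0)) *\<^sub>t \<alpha> ^\<^sub>t l | k l c. True}"

definition nilpotent_pair :: "'a::comm_semiring_1 \<times> 'a \<Rightarrow> bool" where
  "nilpotent_pair \<alpha> \<longleftrightarrow> GP \<alpha> \<inter> Id \<noteq> {}"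

end

theory Submission
  imports Defs
begin

text \<open>
  If \<open>GP \<alpha>\<close> misses \<open>I\<close>, take a congruence \<open>J \<supseteq> I\<close> that is maximal among those missing \<open>GP \<alpha>\<close>.
  Comparing \<open>J\<close> with the congruence \<open>{(a, b). (a x, b x) \<in> J}\<close> and with the one generated by \<open>J\<close>
  and \<open>(x, 0)\<close> shows that \<open>J\<close> is cancellative; the freedom in the summand \<open>c\<close> of a generalized
  power is exactly what is needed to absorb the multiples of \<open>x\<close>. Modulo a cancellative congruence
  the twisted annihilator \<open>{\<beta>. \<beta> \<gamma> \<in> J}\<close> of any pair \<open>\<gamma>\<close> is transitive, hence itself a congruence.
  So if \<open>\<beta> \<gamma> \<in> J\<close> with \<open>\<beta>, \<gamma> \<notin> J\<close>, maximality yields first some \<open>g \<in> GP \<alpha>\<close> annihilating \<open>\<gamma>\<close> and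
  then some \<open>g' \<in> GP \<alpha>\<close> annihilated by \<open>g\<close>; but \<open>g g' \<in> GP \<alpha>\<close>, a contradiction, so \<open>J\<close> is prime.
\<close>

section \<open>Twisted products and generalized powers\<close>

lemma add_left_idem: "a + (a + b) = a + (b::'a::b_algebra)"
  by (simp add: add.assoc [symmetric] add_idem)

lemmas idem_simps = algebra_simps add_idem add_left_idem

lemma twist_mult_comm: "\<alpha> *\<^sub>t \<beta> = \<beta> *\<^sub>t \<alpha>"
  by (simp add: twist_mult_def algebra_simps)

lemma twist_mult_assoc: "(\<alpha> *\<^sub>t \<beta>) *\<^sub>t \<gamma> = \<alpha> *\<^sub>t (\<beta> *\<^sub>t \<gamma>)"
  by (simp add: twist_mult_def algebra_simps)

lemma twist_mult_left_comm: "\<alpha> *\<^sub>t (\<beta> *\<^sub>t \<gamma>) = \<beta> *\<^sub>t (\<alpha> *\<^sub>t \<gamma>)"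
  by (simp add: twist_mult_def algebra_simps)

lemmas twist_mult_ac = twist_mult_assoc twist_mult_comm twist_mult_left_comm

lemma twist_mult_scalar [simp]: "(d, 0) *\<^sub>t \<alpha> = (d * fst \<alpha>, d * snd \<alpha>)"
  by (simp add: twist_mult_def)

lemma twist_pow_add: "\<alpha> ^\<^sub>t (m + n) = \<alpha> ^\<^sub>t m *\<^sub>t \<alpha> ^\<^sub>t n"
  by (induction m) (simp_all add: twist_mult_assoc)

lemma twist_pow_scalar [simp]: "(s, 0) ^\<^sub>t k = (s ^ k, 0)"
  by (induction k) simp_all

lemma fst_plus_snd_twist_mult:
  "fst (\<alpha> *\<^sub>t \<beta>) + snd (\<alpha> *\<^sub>t \<beta>) = (fst \<alpha> + snd \<alpha>) * (fst \<beta> + snd \<beta>)"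
  by (simp add: twist_mult_def algebra_simps)

lemma fst_plus_snd_twist_pow: "fst (\<alpha> ^\<^sub>t n) + snd (\<alpha> ^\<^sub>t n) = (fst \<alpha> + snd \<alpha>) ^ n"
  by (induction n) (simp_all add: fst_plus_snd_twist_mult)

lemma mem_GP_iff:
  "g \<in> GP \<alpha> \<longleftrightarrow> (\<exists>k l c. g = ((fst \<alpha> + snd \<alpha>) ^ k + c, 0) *\<^sub>t \<alpha> ^\<^sub>t l)"
  by (simp add: GP_def pair_star_def)

lemma self_in_GP: "\<alpha> \<in> GP (\<alpha> :: 'a::b_algebra \<times> 'a)"
  unfolding mem_GP_iff
  by (rule exI [of _ 0], rule exI [of _ 1], rule exI [of _ 0]) (simp add: twist_mult_def)

lemma scalar_in_GP: "((fst \<alpha> + snd \<alpha>) ^ k + c, 0) \<in> GP \<alpha>"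
  unfolding mem_GP_iff
  by (rule exI [of _ k], rule exI [of _ 0], rule exI [of _ c]) simp

text \<open>Scalars and powers of \<alpha> can be collected separately. The product of the two
  scalars is \<open>s ^ (k + k')\<close> plus mixed terms, which the arbitrary summand of a
  generalized power takes up.\<close>

lemma GP_twist_mult:
  assumes "g \<in> GP \<alpha>" "h \<in> GP \<alpha>"
  shows "g *\<^sub>t h \<in> GP \<alpha>"
proof -
  define s where "s = fst \<alpha> + snd \<alpha>"
  from assms obtain k l c k' l' c' where
    g: "g = (s ^ k + c, 0) *\<^sub>t \<alpha> ^\<^sub>t l" and h: "h = (s ^ k' + c', 0) *\<^sub>t \<alpha> ^\<^sub>t l'"
    unfolding mem_GP_iff s_def by blast
  have "g *\<^sub>t h = ((s ^ k + c, 0) *\<^sub>t (s ^ k' + c', 0)) *\<^sub>t (\<alpha> ^\<^sub>t l *\<^sub>t \<alpha> ^\<^sub>t l')"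
    unfolding g h by (simp only: twist_mult_ac)
  also have "(s ^ k + c, 0) *\<^sub>t (s ^ k' + c', 0) = (s ^ (k + k') + (s ^ k * c' + c * s ^ k' + c * c'), 0)"
    by (simp add: algebra_simps power_add)
  finally show ?thesis
    unfolding mem_GP_iff s_def twist_pow_add [symmetric] by blast
qed

text \<open>The sum of components is multiplicative for the twisted product, so for \<open>g\<close>
  it equals \<open>(s ^ k + c) * s ^ l\<close>, which absorbs \<open>s ^ (k + l)\<close>. Such a
  power serves as \<open>m\<close> in \<open>scaled_GP_product\<close>.\<close>

lemma GP_power_le_sum:
  fixes \<alpha> :: "'a::b_algebra \<times> 'a"
  assumes "g \<in> GP \<alpha>"
  obtains K where "(fst \<alpha> + snd \<alpha>) ^ K + (fst g + snd g) = fst g + snd g"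
proof -
  define s where "s = fst \<alpha> + snd \<alpha>"
  from assms obtain k l c where g: "g = (s ^ k + c, 0) *\<^sub>t \<alpha> ^\<^sub>t l"
    unfolding mem_GP_iff s_def by blast
  have "fst g + snd g = (s ^ k + c) * s ^ l"
    unfolding g fst_plus_snd_twist_mult fst_plus_snd_twist_pow by (simp add: s_def)
  then have "s ^ (k + l) + (fst g + snd g) = fst g + snd g"
    by (simp add: power_add idem_simps)
  with that show thesis unfolding s_def .
qed

section \<open>Equality and order modulo a congruence\<close>

locale b_congruence =
  fixes J :: "('a::b_algebra \<times> 'a) set"
  assumes congruence: "semiring_congruence J"
begin

abbreviation ceq (infix "\<approx>" 50) where "x \<approx> y \<equiv> (x, y) \<in> J"

text \<open>The natural order of the quotient: idempotent addition is its join, and 0 its least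
  element.\<close>

definition cle (infix "\<preceq>" 50) where "x \<preceq> y \<longleftrightarrow> x + y \<approx> y"

lemma ceq_refl [simp]: "x \<approx> x"
  using congruence by (auto simp: semiring_congruence_def equiv_def refl_on_def)

lemma ceq_sym: "x \<approx> y \<Longrightarrow> y \<approx> x"
  using congruence by (auto simp: semiring_congruence_def equiv_def sym_def)

lemma ceq_trans [trans]: "x \<approx> y \<Longrightarrow> y \<approx> z \<Longrightarrow> x \<approx> z"
  using congruence unfolding semiring_congruence_def equiv_def by (meson transD)

lemma ceq_add: "a \<approx> b \<Longrightarrow> c \<approx> d \<Longrightarrow> a + c \<approx> b + d"
  using congruence by (auto simp: semiring_congruence_def)

lemma ceq_mult: "a \<approx> b \<Longrightarrow> c \<approx> d \<Longrightarrow> a * c \<approx> b * d"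
  using congruence by (auto simp: semiring_congruence_def)

text \<open>Multiplying \<open>fst \<beta> \<approx> snd \<beta>\<close> by the two components of
  \<gamma>, once in each direction, and adding gives the claim; a congruence thus behaves like an
  ideal for the twisted product.\<close>

lemma twist_mult_closed: "\<beta> \<in> J \<Longrightarrow> \<beta> *\<^sub>t \<gamma> \<in> J"
proof -
  assume "\<beta> \<in> J"
  then have *: "fst \<beta> \<approx> snd \<beta>" by simp
  have "fst \<beta> * fst \<gamma> + snd \<beta> * snd \<gamma> \<approx> snd \<beta> * fst \<gamma> + fst \<beta> * snd \<gamma>"
    by (intro ceq_add ceq_mult * ceq_sym [OF *] ceq_refl)
  then show ?thesis by (simp add: twist_mult_def add.commute)
qed

lemma one_ceq_zero_imp_UNIV:
  assumes "1 \<approx> 0" shows "J = UNIV"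
proof -
  have "x \<approx> y" for x y
  proof -
    have "x \<approx> 0" "y \<approx> 0"
      using ceq_mult [OF assms ceq_refl, of x] ceq_mult [OF assms ceq_refl, of y] by simp_all
    then show ?thesis by (blast intro: ceq_trans ceq_sym)
  qed
  then show ?thesis by auto
qed

lemma cle_if_ceq: "x \<approx> y \<Longrightarrow> x \<preceq> y"
  using ceq_add [of x y y y] by (simp add: cle_def add_idem)

lemma cle_if_eq: "x + y = y \<Longrightarrow> x \<preceq> y"
  by (simp add: cle_def)

lemma cle_antisym: "x \<preceq> y \<Longrightarrow> y \<preceq> x \<Longrightarrow> x \<approx> y"
  unfolding cle_def by (metis add.commute ceq_sym ceq_trans)

lemma cle_trans [trans]:
  assumes "x \<preceq> y" "y \<preceq> z" shows "x \<preceq> z"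
proof -
  have "x + z \<approx> x + (y + z)" by (intro ceq_add ceq_refl ceq_sym [OF assms(2) [unfolded cle_def]])
  also have "x + (y + z) \<approx> y + z" using ceq_add [OF assms(1) [unfolded cle_def] ceq_refl, of z]
    by (simp add: add.assoc)
  also have "y + z \<approx> z" using assms(2) by (simp add: cle_def)
  finally show ?thesis by (simp add: cle_def)
qed

lemma cle_add_least:
  assumes "x \<preceq> z" "y \<preceq> z" shows "x + y \<preceq> z"
  using ceq_add [OF assms [unfolded cle_def]] by (simp add: cle_def idem_simps)

lemma cle_add_mono:
  assumes "x \<preceq> y" "z \<preceq> w" shows "x + z \<preceq> y + w"
  using ceq_add [OF assms [unfolded cle_def]] by (simp add: cle_def algebra_simps)

lemma cle_mult_right: "x \<preceq> y \<Longrightarrow> x * z \<preceq> y * z"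
  using ceq_mult [of "x + y" y z z] by (simp add: cle_def algebra_simps)

lemma summand_ceq_zero:
  assumes "a + b \<approx> 0" shows "a \<approx> 0"
proof -
  have "a = a + 0" by simp
  also have "\<dots> \<approx> a + (a + b)" by (intro ceq_add ceq_refl ceq_sym [OF assms])
  also have "a + (a + b) = a + b" by (rule add_left_idem)
  also have "\<dots> \<approx> 0" by (rule assms)
  finally show ?thesis .
qed

lemma zero_cle: "x \<approx> 0 \<Longrightarrow> x \<preceq> y"
  by (blast intro: cle_trans cle_if_ceq cle_if_eq add_0_left)

end

section \<open>Constructions of congruences\<close>

lemma semiring_congruenceI:
  assumes refl: "\<And>x. (x, x) \<in> I"
    and sym: "\<And>x y. (x, y) \<in> I \<Longrightarrow> (y, x) \<in> I"
    and trans: "\<And>x y z. (x, y) \<in> I \<Longrightarrow> (y, z) \<in> I \<Longrightarrow> (x, z) \<in> I"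
    and add: "\<And>x y z. (x, y) \<in> I \<Longrightarrow> (x + z, y + z) \<in> I"
    and mult: "\<And>x y z. (x, y) \<in> I \<Longrightarrow> (x * z, y * z) \<in> I"
  shows "semiring_congruence I"
  unfolding semiring_congruence_def
proof (intro conjI allI impI)
  show "equiv UNIV I"
    by (intro equivI refl_onI symI transI subset_UNIV [of I, folded UNIV_Times_UNIV])
      (rule refl, erule sym, erule trans, assumption)
next
  fix a b c d assume ab: "(a, b) \<in> I" and cd: "(c, d) \<in> I"
  have "(b + c, b + d) \<in> I" "(b * c, b * d) \<in> I"
    using add [OF cd, of b] mult [OF cd, of b] by (simp_all add: ac_simps)
  then show "(a + c, b + d) \<in> I" "(a * c, b * d) \<in> I"
    using trans [OF add [OF ab]] trans [OF mult [OF ab]] by blast+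
qed

lemma semiring_congruence_Id: "semiring_congruence Id"
  by (rule semiring_congruenceI) auto

text \<open>Transitivity is where the chain condition enters: the two given pairs must lie in a
  common member.\<close>

lemma semiring_congruence_Union_chain:
  assumes cong: "\<And>J. J \<in> C \<Longrightarrow> semiring_congruence J" and "C \<noteq> {}"
    and chain: "\<And>J K. J \<in> C \<Longrightarrow> K \<in> C \<Longrightarrow> J \<subseteq> K \<or> K \<subseteq> J"
  shows "semiring_congruence (\<Union>C :: ('a::b_algebra \<times> 'a) set)"
proof (rule semiring_congruenceI)
  have C: "b_congruence J" if "J \<in> C" for J using cong [OF that] by unfold_locales
  show "(x, x) \<in> \<Union>C" for x using \<open>C \<noteq> {}\<close> b_congruence.ceq_refl [OF C] by blast
  show "(y, x) \<in> \<Union>C" if "(x, y) \<in> \<Union>C" for x y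
    using that b_congruence.ceq_sym [OF C] by blast
  show "(x, z) \<in> \<Union>C" if "(x, y) \<in> \<Union>C" "(y, z) \<in> \<Union>C" for x y z
  proof -
    from that obtain J K where "J \<in> C" "K \<in> C" "(x, y) \<in> J" "(y, z) \<in> K" by blast
    with chain [of J K] show ?thesis using b_congruence.ceq_trans [OF C] by blast
  qed
  show "(x + z, y + z) \<in> \<Union>C" if "(x, y) \<in> \<Union>C" for x y z
    using that b_congruence.ceq_add [OF C] b_congruence.ceq_refl [OF C] by blast
  show "(x * z, y * z) \<in> \<Union>C" if "(x, y) \<in> \<Union>C" for x y z
    using that b_congruence.ceq_mult [OF C] b_congruence.ceq_refl [OF C] by blast
qed

context b_congruence
begin

lemma congruence_scalar_quotient: "semiring_congruence {(a, b). a * x \<approx> b * x}"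
proof (rule semiring_congruenceI, goal_cases)
  case (4 a b z)
  then show ?case using ceq_add [of "a * x" "b * x" "z * x" "z * x"] by (simp add: algebra_simps)
next
  case (5 a b z)
  then show ?case using ceq_mult [of "a * x" "b * x" z z] by (simp add: algebra_simps)
next
  case (3 a b c)
  then show ?case by (simp add: ceq_trans [of "a * x" "b * x" "c * x"])
qed (simp_all add: ceq_sym)

text \<open>This is the least congruence containing \<open>J\<close> and \<open>(x, 0)\<close>. For
  transitivity the two witnesses are added.\<close>

lemma congruence_generated_by_zeroing:
  "semiring_congruence {(a, b). \<exists>y. a + x * y \<approx> b + x * y}"
proof (rule semiring_congruenceI, goal_cases)
  case (3 a b c)
  then obtain y z where y: "a + x * y \<approx> b + x * y" and z: "b + x * z \<approx> c + x * z" by auto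
  have "a + x * (y + z) = (a + x * y) + x * z" by (simp add: algebra_simps)
  also have "\<dots> \<approx> (b + x * y) + x * z" by (intro ceq_add y ceq_refl)
  also have "(b + x * y) + x * z = (b + x * z) + x * y" by (simp add: algebra_simps)
  also have "\<dots> \<approx> (c + x * z) + x * y" by (intro ceq_add z ceq_refl)
  also have "(c + x * z) + x * y = c + x * (y + z)" by (simp add: algebra_simps)
  finally show ?case by auto
next
  case (4 a b z)
  then obtain y where "a + x * y \<approx> b + x * y" by auto
  from ceq_add [OF this ceq_refl, of z] show ?case by (auto simp: algebra_simps)
next
  case (5 a b z)
  then obtain y where "a + x * y \<approx> b + x * y" by auto
  from ceq_mult [OF this ceq_refl, of z] have "a * z + x * (y * z) \<approx> b * z + x * (y * z)"
    by (simp add: algebra_simps)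
  then show ?case by blast
qed (auto dest: ceq_sym)

text \<open>Let \<open>h\<close> be the product of \<open>g\<close> and \<open>g'\<close>. The
  components of \<open>h\<close> agree modulo \<open>J\<close> after multiplication by
  \<open>x\<close>, and also after adding \<open>x * y * t\<close>. The factor
  \<open>m + x * y\<close> combines both facts: its part \<open>x * y\<close> supplies the term that
  its part \<open>m\<close> needs for exchanging the components.\<close>

lemma scaled_GP_product:
  assumes g: "fst g * x \<approx> snd g * x"
    and g': "fst g' + x * y \<approx> snd g' + x * y"
    and m: "m + (fst g' + snd g') = fst g' + snd g'"
  shows "(m + x * y, 0) *\<^sub>t (g *\<^sub>t g') \<in> J"
proof -
  define t where "t = fst g + snd g"
  define t' where "t' = fst g' + snd g'"
  define h1 where "h1 = fst (g *\<^sub>t g')"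
  define h2 where "h2 = snd (g *\<^sub>t g')"
  have "(fst g * x, snd g * x) *\<^sub>t g' \<in> J" using g by (rule twist_mult_closed)
  then have "x * h1 \<approx> x * h2"
    by (simp add: h1_def h2_def twist_mult_def algebra_simps)
  from ceq_mult [OF ceq_refl this, of y] have xh: "x * y * h1 \<approx> x * y * h2"
    by (simp add: algebra_simps)
  have "(fst g' + x * y, snd g' + x * y) *\<^sub>t g \<in> J" using g' by (rule twist_mult_closed)
  then have h: "h1 + x * y * t \<approx> h2 + x * y * t"
    by (simp add: h1_def h2_def t_def twist_mult_def algebra_simps)
  have sum: "h1 + h2 = t * (m + t')"
    using m unfolding h1_def h2_def fst_plus_snd_twist_mult t_def t'_def by simp
  have absorb1: "x * y * h1 \<approx> x * y * (h1 + h2)"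
    using ceq_add [OF ceq_refl xh, of "x * y * h1"] by (simp add: distrib_left add_idem)
  have absorb2: "x * y * (h1 + h2) \<approx> x * y * h2"
    using ceq_add [OF xh ceq_refl, of "x * y * h2"] by (simp add: distrib_left add_idem)
  have "(m + x * y) * h1 = m * h1 + x * y * h1" by (simp add: algebra_simps)
  also have "\<dots> \<approx> m * h1 + x * y * (h1 + h2)" by (intro ceq_add absorb1 ceq_refl)
  \<comment> \<open>By \<open>sum\<close>, \<open>x * y * (h1 + h2)\<close> equals
    \<open>x * y * t * (m + t')\<close>, so it already has \<open>m * (x * y * t)\<close> as a
    summand.\<close>
  also have "m * h1 + x * y * (h1 + h2) = m * (h1 + x * y * t) + x * y * (h1 + h2)"
    unfolding sum by (simp add: idem_simps)
  also have "\<dots> \<approx> m * (h2 + x * y * t) + x * y * (h1 + h2)"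
    by (intro ceq_add ceq_mult h ceq_refl)
  also have "m * (h2 + x * y * t) + x * y * (h1 + h2) = m * h2 + x * y * (h1 + h2)"
    unfolding sum by (simp add: idem_simps)
  also have "\<dots> \<approx> m * h2 + x * y * h2" by (intro ceq_add absorb2 ceq_refl)
  also have "m * h2 + x * y * h2 = (m + x * y) * h2" by (simp add: algebra_simps)
  finally show ?thesis by (simp add: h1_def h2_def)
qed

end

section \<open>Cancellative congruences and twisted annihilators\<close>

locale cancellative_congruence = b_congruence +
  assumes cancel: "a * x \<approx> b * x \<Longrightarrow> \<not> x \<approx> 0 \<Longrightarrow> a \<approx> b"
begin

lemma cle_cancel: "a * x \<preceq> b * x \<Longrightarrow> \<not> x \<approx> 0 \<Longrightarrow> a \<preceq> b"
  using cancel [of "a + b" x b] by (simp add: cle_def algebra_simps)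

text \<open>Joining \<open>u * v\<close> to the left side yields \<open>u * (u + v)\<close> below
  \<open>v * (u + v)\<close>, and \<open>u + v\<close> cancels unless it vanishes.\<close>

lemma cle_if_square_cle:
  assumes "u * u \<preceq> u * v + v * v" shows "u \<preceq> v"
proof (cases "u + v \<approx> 0")
  case True
  then show ?thesis by (rule zero_cle [OF summand_ceq_zero])
next
  case False
  have "u * (u + v) = u * u + u * v" by (simp add: algebra_simps)
  also have "\<dots> \<preceq> u * v + v * v"
    by (intro cle_add_least assms cle_if_eq) (simp add: idem_simps)
  also have "\<dots> = v * (u + v)" by (simp add: algebra_simps)
  finally show ?thesis using False by (rule cle_cancel)
qed

text \<open>
  In a totally ordered quotient the hypotheses say that \<open>a \<preceq> b \<preceq> c\<close> unless \<open>q \<preceq> p\<close>. In the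
  semifield of fractions they become \<open>b/(a+b) + p/(p+q) = 1\<close> and \<open>c/(b+c) + p/(p+q) = 1\<close>;
  multiplying the two gives \<open>bc/((a+b)(b+c)) + p/(p+q) = 1\<close>. The proof clears denominators.
\<close>
lemma cle_twist_trans:
  assumes ab: "a * q \<preceq> a * p + b * q" and bc: "b * q \<preceq> b * p + c * q"
  shows "a * q \<preceq> a * p + c * q"
proof (cases "p + q \<approx> 0 \<or> a + b \<approx> 0 \<or> b + c \<approx> 0")
  case True
  \<comment> \<open>A sum vanishes only if both summands do, so each vanishing denominator kills one
    of these three elements.\<close>
  then consider "q \<approx> 0" | "a \<approx> 0" | "b \<approx> 0"
    by (metis add.commute summand_ceq_zero)
  then show ?thesis
  proof cases
    case 1
    then have "a * q \<approx> 0" using ceq_mult [OF ceq_refl [of a] 1] by simp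
    then show ?thesis by (rule zero_cle)
  next
    case 2
    then have "a * q \<approx> 0" using ceq_mult [OF 2 ceq_refl [of q]] by simp
    then show ?thesis by (rule zero_cle)
  next
    case 3
    then have "b * q \<preceq> c * q" using ceq_mult [OF 3 ceq_refl [of q]] by (simp add: zero_cle)
    then have "a * p + b * q \<preceq> a * p + c * q"
      by (intro cle_add_mono) (simp_all add: cle_def add_idem)
    with ab show ?thesis by (rule cle_trans)
  qed
next
  case False
  define D where "D = a + b"
  define E where "E = b + c"
  define R where "R = p + q"
  define F where "F = a + c"
  have nz: "\<not> D \<approx> 0" "\<not> E \<approx> 0" "\<not> R \<approx> 0"
    using False by (simp_all add: D_def E_def R_def)
  \<comment> \<open>Joining the remaining terms of \<open>D * R\<close> to both sides of
    \<open>ab\<close> gives the cleared form of \<open>b / D + p / R = 1\<close>.\<close>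
  have "D * R = a * q + (a * p + b * p + b * q)" by (simp add: D_def R_def algebra_simps)
  also have "\<dots> \<preceq> (a * p + b * q) + (a * p + b * p + b * q)"
    by (intro cle_add_mono ab cle_if_eq) (simp add: idem_simps)
  also have "\<dots> = b * R + p * D" by (simp add: D_def R_def idem_simps)
  finally have DR: "D * R \<preceq> b * R + p * D" .
  have "E * R = b * q + (b * p + c * p + c * q)" by (simp add: E_def R_def algebra_simps)
  also have "\<dots> \<preceq> (b * p + c * q) + (b * p + c * p + c * q)"
    by (intro cle_add_mono bc cle_if_eq) (simp add: idem_simps)
  also have "\<dots> = c * R + p * E" by (simp add: E_def R_def idem_simps)
  finally have ER: "E * R \<preceq> c * R + p * E" .
  have "(D * E * R) * R = (D * R) * (E * R)" by (simp add: algebra_simps)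
  also have "\<dots> \<preceq> (b * R + p * D) * (E * R)" using DR by (rule cle_mult_right)
  also have "\<dots> = (E * R) * (b * R + p * D)" by (rule mult.commute)
  also have "\<dots> \<preceq> (c * R + p * E) * (b * R + p * D)" using ER by (rule cle_mult_right)
  also have "\<dots> = b * c * R * R + (c * (p * D * R) + b * (p * E * R) + p * (p * D * E))"
    by (simp add: algebra_simps)
  also have "\<dots> \<preceq> b * c * R * R + p * D * E * R"
  proof (intro cle_add_mono cle_add_least)
    show "b * c * R * R \<preceq> b * c * R * R" by (rule cle_if_eq) (rule add_idem)
    show "c * (p * D * R) \<preceq> p * D * E * R"
      by (rule cle_if_eq) (simp add: E_def idem_simps)
    show "b * (p * E * R) \<preceq> p * D * E * R"
      by (rule cle_if_eq) (simp add: D_def idem_simps)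
    show "p * (p * D * E) \<preceq> p * D * E * R"
      by (rule cle_if_eq) (simp add: R_def idem_simps)
  qed
  also have "\<dots> = (b * c * R + p * D * E) * R" by (simp add: algebra_simps)
  finally have DER: "D * E * R \<preceq> b * c * R + p * D * E" using nz by (blast intro: cle_cancel)
  \<comment> \<open>The denominator \<open>D * E\<close> is now traded for \<open>F\<close>:
    \<open>b * c / (D * E)\<close> is at most \<open>c / F\<close>.\<close>
  have "(F * R * D) * E = (D * E * R) * F" by (simp add: algebra_simps)
  also have "\<dots> \<preceq> (b * c * R + p * D * E) * F" using DER by (rule cle_mult_right)
  also have "\<dots> = b * c * F * R + p * D * E * F" by (simp add: algebra_simps)
  also have "\<dots> \<preceq> c * D * E * R + p * D * E * F"
  proof (intro cle_add_mono cle_mult_right)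
    show "b * c * F \<preceq> c * D * E"
      by (rule cle_if_eq) (simp add: D_def E_def F_def idem_simps)
    show "p \<preceq> p" by (rule cle_if_eq) (rule add_idem)
  qed
  also have "\<dots> = ((c * R + p * F) * D) * E" by (simp add: algebra_simps)
  finally have FR: "F * R \<preceq> c * R + p * F" using nz by (blast intro: cle_cancel)
  have "a * q \<preceq> F * R" by (rule cle_if_eq) (simp add: F_def R_def idem_simps)
  also note FR
  also have "c * R + p * F = a * p + c * p + c * q" by (simp add: F_def R_def idem_simps)
  finally have weak: "a * q \<preceq> a * p + c * p + c * q" .
  \<comment> \<open>The term \<open>c * p\<close> is removed using \<open>(a * q) * (c * p) = (a * p) * (c * q)\<close>.\<close>
  show ?thesis
  proof (rule cle_if_square_cle)
    have "(a * q) * (a * q) \<preceq> (a * p + c * p + c * q) * (a * q)" using weak by (rule cle_mult_right)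
    also have "\<dots> \<preceq> (a * q) * (a * p + c * q) + (a * p + c * q) * (a * p + c * q)"
      by (rule cle_if_eq) (simp add: idem_simps)
    finally show "(a * q) * (a * q) \<preceq> (a * q) * (a * p + c * q) + (a * p + c * q) * (a * p + c * q)" .
  qed
qed

text \<open>A sum is a join, so the equation splits into one inequality per summand. The four have
  the shape required by \<open>cle_twist_trans\<close>, up to exchanging \<open>p\<close> with
  \<open>q\<close> or \<open>a\<close> with \<open>b\<close>.\<close>

lemma ann_imp_cle:
  assumes "(a, b) *\<^sub>t (p, q) \<in> J"
  shows "a * q \<preceq> a * p + b * q" "a * p \<preceq> a * q + b * p"
    "b * q \<preceq> b * p + a * q" "b * p \<preceq> b * q + a * p"
proof -
  have eq: "a * p + b * q \<approx> a * q + b * p" using assms by (simp add: twist_mult_def)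
  have sum: "x \<preceq> z" if "x + y \<preceq> z" for x y z
    by (rule cle_trans [OF _ that]) (simp add: cle_if_eq add_left_idem)
  note le = cle_if_ceq [OF eq] cle_if_ceq [OF ceq_sym [OF eq]]
  from le le [unfolded add.commute [of "a * p"] add.commute [of "a * q"]]
  show "a * q \<preceq> a * p + b * q" "a * p \<preceq> a * q + b * p"
    "b * q \<preceq> b * p + a * q" "b * p \<preceq> b * q + a * p"
    by (metis sum add.commute)+
qed

lemma annihilator_congruence: "semiring_congruence {\<beta>. \<beta> *\<^sub>t \<gamma> \<in> J}"
proof -
  obtain p q where \<gamma>: "\<gamma> = (p, q)" by force
  show ?thesis unfolding \<gamma>
  proof (rule semiring_congruenceI, goal_cases)
    case (1 x)
    then show ?case by (simp add: twist_mult_def add.commute)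
  next
    case (2 x y)
    then have "x * p + y * q \<approx> x * q + y * p" by (simp add: twist_mult_def)
    from ceq_sym [OF this] show ?case by (simp add: twist_mult_def add.commute)
  next
    case (3 a b c)
    then have "(a, b) *\<^sub>t (p, q) \<in> J" "(b, c) *\<^sub>t (p, q) \<in> J" by simp_all
    note ab = ann_imp_cle [OF this(1)] and bc = ann_imp_cle [OF this(2)]
    \<comment> \<open>By antisymmetry one inequality per summand suffices; those for
      \<open>a\<close> pass through \<open>b\<close> to \<open>c\<close>, those for \<open>c\<close>
      pass back through \<open>b\<close> to \<open>a\<close>.\<close>
    have "a * p + c * q \<approx> a * q + c * p"
    proof (rule cle_antisym; rule cle_add_least)
      show "a * p \<preceq> a * q + c * p" using ab(2) bc(2) by (rule cle_twist_trans)
      show "c * q \<preceq> a * q + c * p"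
        using cle_twist_trans [OF bc(3) ab(3)] by (simp add: add.commute)
      show "a * q \<preceq> a * p + c * q" using ab(1) bc(1) by (rule cle_twist_trans)
      show "c * p \<preceq> a * p + c * q"
        using cle_twist_trans [OF bc(4) ab(4)] by (simp add: add.commute)
    qed
    then show ?case by (simp add: twist_mult_def)
  next
    case (4 x y z)
    then have "x * p + y * q \<approx> x * q + y * p" by (simp add: twist_mult_def)
    from ceq_add [OF this ceq_refl, of "z * p + z * q"] show ?case
      by (simp add: twist_mult_def algebra_simps)
  next
    case (5 x y z)
    then have "x * p + y * q \<approx> x * q + y * p" by (simp add: twist_mult_def)
    from ceq_mult [OF this ceq_refl, of z] show ?case
      by (simp add: twist_mult_def algebra_simps)
  qed
qed

end

section \<open>Primality of maximal congruences avoiding generalized powers\<close>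

locale GP_maximal_congruence = b_congruence +
  fixes \<alpha> :: "'a \<times> 'a"
  assumes disjoint: "GP \<alpha> \<inter> J = {}"
    and maximal: "semiring_congruence K \<Longrightarrow> J \<subseteq> K \<Longrightarrow> GP \<alpha> \<inter> K = {} \<Longrightarrow> K = J"
begin

lemma larger_meets_GP:
  assumes "semiring_congruence K" "J \<subseteq> K" "\<beta> \<in> K" "\<beta> \<notin> J"
  obtains g where "g \<in> GP \<alpha>" "g \<in> K"
  using assms maximal [of K] by blast

sublocale cancellative_congruence J
proof
  fix a x b assume ax: "a * x \<approx> b * x" and x: "\<not> x \<approx> 0"
  show "a \<approx> b"
  proof (rule ccontr)
    assume ab: "\<not> a \<approx> b"
    let ?Q = "{(a, b). a * x \<approx> b * x}"
    have "J \<subseteq> ?Q" by (auto intro: ceq_mult ceq_refl)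
    moreover have "(a, b) \<in> ?Q" using ax by simp
    ultimately obtain g where "g \<in> GP \<alpha>" "g \<in> ?Q"
      by (rule larger_meets_GP [OF congruence_scalar_quotient _ _ ab])
    then have g: "g \<in> GP \<alpha>" "fst g * x \<approx> snd g * x" by auto
    let ?K = "{(a, b). \<exists>y. a + x * y \<approx> b + x * y}"
    have "J \<subseteq> ?K" by (auto intro: ceq_add ceq_refl)
    moreover have "(x, 0) \<in> ?K" by (auto intro!: exI [of _ 1] simp: add_idem)
    ultimately obtain g' where g': "g' \<in> GP \<alpha>" "g' \<in> ?K"
      by (rule larger_meets_GP [OF congruence_generated_by_zeroing _ _ x])
    then obtain y where y: "fst g' + x * y \<approx> snd g' + x * y" by auto
    obtain K where "(fst \<alpha> + snd \<alpha>) ^ K + (fst g' + snd g') = fst g' + snd g'"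
      using GP_power_le_sum [OF g'(1)] .
    from scaled_GP_product [OF g(2) y this]
    have "((fst \<alpha> + snd \<alpha>) ^ K + x * y, 0) *\<^sub>t (g *\<^sub>t g') \<in> J" .
    \<comment> \<open>The scalar is a generalized power with arbitrary summand
      \<open>x * y\<close>.\<close>
    moreover have "((fst \<alpha> + snd \<alpha>) ^ K + x * y, 0) *\<^sub>t (g *\<^sub>t g') \<in> GP \<alpha>"
      by (intro GP_twist_mult scalar_in_GP g g')
    ultimately show False using disjoint by blast
  qed
qed

lemma subset_annihilator: "J \<subseteq> {\<beta>. \<beta> *\<^sub>t \<gamma> \<in> J}"
  using twist_mult_closed by blast

lemma prime: "prime_congruence J"
  unfolding prime_congruence_def
proof (intro conjI allI impI)
  show "semiring_congruence J" by (rule congruence)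
  show "J \<noteq> UNIV" using self_in_GP [of \<alpha>] disjoint by blast
  fix \<beta> \<gamma> assume \<beta>\<gamma>: "\<beta> *\<^sub>t \<gamma> \<in> J"
  show "\<beta> \<in> J \<or> \<gamma> \<in> J"
  proof (rule ccontr)
    assume *: "\<not> (\<beta> \<in> J \<or> \<gamma> \<in> J)"
    with \<beta>\<gamma> obtain g where g: "g \<in> GP \<alpha>" "g *\<^sub>t \<gamma> \<in> J"
      using larger_meets_GP [OF annihilator_congruence subset_annihilator, of \<beta> \<gamma>] by blast
    \<comment> \<open>Now \<gamma>, which is not in \<open>J\<close>, shows that the annihilator of
      \<open>g\<close> is strictly larger than \<open>J\<close>.\<close>
    then have "\<gamma> *\<^sub>t g \<in> J" by (simp add: twist_mult_comm)
    with * obtain g' where g': "g' \<in> GP \<alpha>" "g' *\<^sub>t g \<in> J"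
      using larger_meets_GP [OF annihilator_congruence subset_annihilator, of \<gamma> g] by blast
    with g GP_twist_mult [of g' \<alpha> g] disjoint show False by blast
  qed
qed

end

section \<open>The two inclusions for the radical\<close>

lemma ex_prime_avoiding_GP:
  fixes I :: "('a::b_algebra \<times> 'a) set"
  assumes I: "semiring_congruence I" and disj: "GP \<alpha> \<inter> I = {}"
  obtains P where "prime_congruence P" "I \<subseteq> P" "\<alpha> \<notin> P"
proof -
  define S where "S = {J. semiring_congruence J \<and> I \<subseteq> J \<and> GP \<alpha> \<inter> J = {}}"
  have "\<exists>M\<in>S. \<forall>X\<in>S. M \<subseteq> X \<longrightarrow> X = M"
  proof (rule subset_Zorn_nonempty)
    show "S \<noteq> {}" using I disj by (auto simp: S_def)
    fix C assume C: "C \<noteq> {}" "subset.chain S C"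
    then have "C \<subseteq> S" and "\<And>J K. J \<in> C \<Longrightarrow> K \<in> C \<Longrightarrow> J \<subseteq> K \<or> K \<subseteq> J"
      by (auto simp: subset_chain_def)
    then have "semiring_congruence (\<Union>C)"
      using C by (intro semiring_congruence_Union_chain) (auto simp: S_def)
    with \<open>C \<subseteq> S\<close> \<open>C \<noteq> {}\<close> show "\<Union>C \<in> S" by (fastforce simp: S_def)
  qed
  then obtain M where M: "M \<in> S" and max: "\<And>X. X \<in> S \<Longrightarrow> M \<subseteq> X \<Longrightarrow> X = M" by blast
  interpret GP_maximal_congruence M \<alpha>
    using M max by unfold_locales (auto simp: S_def)
  show thesis
    using that [of M] prime M self_in_GP [of \<alpha>] by (auto simp: S_def)
qed

text \<open>Primality puts the scalar factor or a power of \<alpha> into \<open>P\<close>. In the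
  scalar case the summand \<open>s ^ k\<close> vanishes modulo \<open>P\<close>, hence so does
  \<open>s\<close>, and with it both components of \<alpha>.\<close>

lemma prime_contains_if_GP_meets:
  fixes P :: "('a::b_algebra \<times> 'a) set"
  assumes P: "prime_congruence P" and "g \<in> GP \<alpha>" "g \<in> P"
  shows "\<alpha> \<in> P"
proof -
  interpret b_congruence P using P by unfold_locales (simp add: prime_congruence_def)
  have prime: "\<beta> \<in> P \<or> \<gamma> \<in> P" if "\<beta> *\<^sub>t \<gamma> \<in> P" for \<beta> \<gamma>
    using P that unfolding prime_congruence_def by blast
  \<comment> \<open>Properness excludes the zeroth power, which settles the base case of
    \<open>pow\<close>.\<close>
  have one: "(1, 0) \<notin> P" using P one_ceq_zero_imp_UNIV by (auto simp: prime_congruence_def)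
  have pow: "\<beta> \<in> P" if "\<beta> ^\<^sub>t n \<in> P" for \<beta> n
    using that
  proof (induction n)
    case 0
    with one show ?case by simp
  next
    case (Suc n)
    then show ?case using prime [of \<beta> "\<beta> ^\<^sub>t n"] by (metis twist_pow.simps(2))
  qed
  define s where "s = fst \<alpha> + snd \<alpha>"
  from assms obtain k l c where "(s ^ k + c, 0) *\<^sub>t \<alpha> ^\<^sub>t l \<in> P"
    unfolding mem_GP_iff s_def by blast
  then consider "(s ^ k + c, 0) \<in> P" | "\<alpha> ^\<^sub>t l \<in> P" using prime by blast
  then show ?thesis
  proof cases
    case 1
    then have "(s, 0) ^\<^sub>t k \<in> P" using summand_ceq_zero by simp
    then have "(s, 0) \<in> P" by (rule pow)
    then have "(fst \<alpha>, 0) \<in> P" "(snd \<alpha>, 0) \<in> P"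
      unfolding s_def by (metis add.commute summand_ceq_zero)+
    then have "(fst \<alpha>, snd \<alpha>) \<in> P" by (blast intro: ceq_trans ceq_sym)
    then show ?thesis by simp
  qed (rule pow)
qed

lemma Rad_eq:
  fixes I :: "('a::b_algebra \<times> 'a) set"
  assumes "semiring_congruence I"
  shows "Rad I = {\<alpha>. GP \<alpha> \<inter> I \<noteq> {}}"
proof (intro equalityI subsetI)
  fix \<alpha> assume "\<alpha> \<in> Rad I"
  then show "\<alpha> \<in> {\<alpha>. GP \<alpha> \<inter> I \<noteq> {}}"
    using ex_prime_avoiding_GP [OF assms, of \<alpha>] by (auto simp: Rad_def)
next
  fix \<alpha> assume "\<alpha> \<in> {\<alpha>. GP \<alpha> \<inter> I \<noteq> {}}"
  then show "\<alpha> \<in> Rad I"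
    unfolding Rad_def using prime_contains_if_GP_meets by blast
qed

theorem theorem3p9:
  shows "(\<forall>I :: ('a::b_algebra \<times> 'a) set. semiring_congruence I \<longrightarrow>
            Rad I = {\<alpha>. GP \<alpha> \<inter> I \<noteq> {}}) \<and>
         \<Inter>{P :: ('a \<times> 'a) set. prime_congruence P} = {\<alpha>. nilpotent_pair \<alpha>}"
proof (intro conjI allI impI Rad_eq)
  \<comment> \<open>Congruences are reflexive, so the intersection of all primes is the radical of
    the diagonal.\<close>
  have "Id \<subseteq> P" if "prime_congruence P" for P :: "('a \<times> 'a) set"
    using that by (auto simp: prime_congruence_def semiring_congruence_def equiv_def refl_on_def)
  then have "\<Inter>{P :: ('a \<times> 'a) set. prime_congruence P} = Rad Id"
    unfolding Rad_def by (metis (lifting))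
  also have "\<dots> = {\<alpha>. nilpotent_pair \<alpha>}"
    by (simp add: Rad_eq semiring_congruence_Id nilpotent_pair_def)
  finally show "\<Inter>{P :: ('a \<times> 'a) set. prime_congruence P} = {\<alpha>. nilpotent_pair \<alpha>}" .
qed

end
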